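(* Let $t_1\le t_2$ be real numbers and let $X(F)\subseteq\omega(F)$ be any given sequence space. Suppose that the entries of the infinite real matrices $\Delta=(\delta_{nk})_{n,k\ge1}$ and $\Lambda=(\lambda_{nk})_{n,k\ge1}$ are connected by the relation $$\lambda_{nk}=\sum_{j=1}^{n}j\,\delta_{jk}\qquad (n,k\ge1).$$ Then $\Delta\in\big(X(F):[c(F)]_\Omega\big)$ if and only if $\Lambda\in\big(X(F):c(F)\big)$.
   Context: For fixed real $t_1\le t_2$, $u_{(t_1,t_2)}=(u-t_1,u,u+t_2)$ denotes the triangular fuzzy number with middle point $u\in\mathbb R$, and $F=\{(u-t_1,u,u+t_2):u\in\mathbb R\}$. Operations: $u_{(t_1,t_2)}\oplus v_{(t_1,t_2)}=(u+v-t_1,u+v,u+v+t_2)$ and $\alpha\otimes u_{(t_1,t_2)}=(\alpha u-t_1,\alpha u,\alpha u+t_2)$. Put $\overline d(u_{(t_1,t_2)},v_{(t_1,t_2)})=\max\{|u-v-t_1|,|u-v|,|u-v+t_2|\}$. $\omega(F)$ is the set of all sequences $\widehat u=(u^{k}_{(t_1,t_2)})_{k\ge1}$ in $F$ with termwise operations; each subspace of $\omega(F)$ is called a sequence space. $c(F)=\{\widehat u\in\omega(F):\lim_k\overline d(u^{k}_{(t_1,t_2)},u^{0}_{(t_1,t_2)})=0\text{ for some }u^{0}_{(t_1,t_2)}\in F\}$. For an infinite real matrix $A=(a_{nk})$, $A\widehat u$ has $n$-th term $\big(\sum_k a_{nk}u^k-t_1,\sum_k a_{nk}u^k,\sum_k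 a_{nk}u^k+t_2\big)$, and $A\in(X(F):Y(F))$ means that for every $\widehat u\in X(F)$ these series converge for all $n$ and $A\widehat u\in Y(F)$. $\Omega$ is the matrix with entries $k$ for $1\le k\le n$ and $0$ for $k>n$, and $[c(F)]_\Omega=\{\widehat u\in\omega(F):\Omega\widehat u\in c(F)\}$. *)

theory Defs
  imports Complex_Main "HOL-Library.FuncSet"
begin

text \<open>
  A triangular fuzzy number is represented by its triple (left end, middle point, right end).
  Sequences are indexed by the positive integers: they are functions on \<open>nat\<close> that are
  undefined at \<open>0\<close> (extensional on \<open>{1..}\<close>), and only the entries of a matrix with both
  indices at least \<open>1\<close> matter.
\<close>

type_synonym tfn = "real \<times> real \<times> real"

definition tri :: "real \<Rightarrow> real \<Rightarrow> real \<Rightarrow> tfn" where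
  "tri t1 t2 u = (u - t1, u, u + t2)"

definition mid :: "tfn \<Rightarrow> real" where
  "mid x = fst (snd x)"

definition F :: "real \<Rightarrow> real \<Rightarrow> tfn set" where
  "F t1 t2 = {tri t1 t2 u | u. True}"

text \<open>
  The operations and the distance are given by their formulas in the middle points; they are
  meant for arguments in \<open>F t1 t2\<close>, where they take the displayed form below.
\<close>

definition fadd :: "real \<Rightarrow> real \<Rightarrow> tfn \<Rightarrow> tfn \<Rightarrow> tfn" where
  "fadd t1 t2 x y = tri t1 t2 (mid x + mid y)"

definition fscale :: "real \<Rightarrow> real \<Rightarrow> real \<Rightarrow> tfn \<Rightarrow> tfn" where
  "fscale t1 t2 \<alpha> x = tri t1 t2 (\<alpha> * mid x)"

definition fdist :: "real \<Rightarrow> real \<Rightarrow> tfn \<Rightarrow> tfn \<Rightarrow> real" where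
  "fdist t1 t2 x y =
     Max {\<bar>mid x - mid y - t1\<bar>, \<bar>mid x - mid y\<bar>, \<bar>mid x - mid y + t2\<bar>}"

lemma mid_tri [simp]: "mid (tri t1 t2 u) = u"
  by (simp add: mid_def tri_def)

lemma fadd_tri: "fadd t1 t2 (tri t1 t2 u) (tri t1 t2 v) = (u + v - t1, u + v, u + v + t2)"
  by (simp add: fadd_def) (simp add: tri_def)

lemma fscale_tri: "fscale t1 t2 \<alpha> (tri t1 t2 u) = (\<alpha> * u - t1, \<alpha> * u, \<alpha> * u + t2)"
  by (simp add: fscale_def) (simp add: tri_def)

lemma fdist_tri:
  "fdist t1 t2 (tri t1 t2 u) (tri t1 t2 v) = Max {\<bar>u - v - t1\<bar>, \<bar>u - v\<bar>, \<bar>u - v + t2\<bar>}"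
  by (simp add: fdist_def)

definition omega :: "real \<Rightarrow> real \<Rightarrow> (nat \<Rightarrow> tfn) set" where
  "omega t1 t2 = {1..} \<rightarrow>\<^sub>E F t1 t2"

text \<open>The zero vector of \<open>F t1 t2\<close> under these operations is \<open>tri t1 t2 0\<close>, not the crisp zero.\<close>

definition sequence_space :: "real \<Rightarrow> real \<Rightarrow> (nat \<Rightarrow> tfn) set \<Rightarrow> bool" where
  "sequence_space t1 t2 X \<longleftrightarrow>
     X \<subseteq> omega t1 t2 \<and>
     (\<lambda>k\<in>{1..}. tri t1 t2 0) \<in> X \<and>
     (\<forall>u\<in>X. \<forall>v\<in>X. (\<lambda>k\<in>{1..}. fadd t1 t2 (u k) (v k)) \<in> X) \<and>
     (\<forall>\<alpha>. \<forall>u\<in>X. (\<lambda>k\<in>{1..}. fscale t1 t2 \<alpha> (u k)) \<in> X)"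

text \<open>
  Since \<open>fdist t1 t2 x x\<close> is the maximum of \<open>\<bar>t1\<bar>\<close> and \<open>\<bar>t2\<bar>\<close>, this set is empty unless
  \<open>t1 = t2 = 0\<close>; the definition is nevertheless the literal one.
\<close>

definition c_space :: "real \<Rightarrow> real \<Rightarrow> (nat \<Rightarrow> tfn) set" where
  "c_space t1 t2 =
     {u \<in> omega t1 t2. \<exists>u0\<in>F t1 t2. (\<lambda>k. fdist t1 t2 (u k) u0) \<longlonglongrightarrow> 0}"

text \<open>The shift \<open>Suc k\<close> makes the series run over all indices \<open>k \<ge> 1\<close>.\<close>

definition mat_summable :: "(nat \<Rightarrow> nat \<Rightarrow> real) \<Rightarrow> (nat \<Rightarrow> tfn) \<Rightarrow> bool" where
  "mat_summable A u \<longleftrightarrow> (\<forall>n\<ge>1. summable (\<lambda>k. A n (Suc k) * mid (u (Suc k))))"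

definition mat_app ::
  "real \<Rightarrow> real \<Rightarrow> (nat \<Rightarrow> nat \<Rightarrow> real) \<Rightarrow> (nat \<Rightarrow> tfn) \<Rightarrow> nat \<Rightarrow> tfn" where
  "mat_app t1 t2 A u = (\<lambda>n\<in>{1..}. tri t1 t2 (\<Sum>k. A n (Suc k) * mid (u (Suc k))))"

definition mat_class ::
  "real \<Rightarrow> real \<Rightarrow> (nat \<Rightarrow> tfn) set \<Rightarrow> (nat \<Rightarrow> tfn) set \<Rightarrow> (nat \<Rightarrow> nat \<Rightarrow> real) set" where
  "mat_class t1 t2 X Y = {A. \<forall>u\<in>X. mat_summable A u \<and> mat_app t1 t2 A u \<in> Y}"

definition Omega :: "nat \<Rightarrow> nat \<Rightarrow> real" where
  "Omega n k = (if 1 \<le> k \<and> k \<le> n then real k else 0)"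

text \<open>Each row of \<open>Omega\<close> has finite support, so no summability condition is needed here.\<close>

definition c_Omega :: "real \<Rightarrow> real \<Rightarrow> (nat \<Rightarrow> tfn) set" where
  "c_Omega t1 t2 = {u \<in> omega t1 t2. mat_app t1 t2 Omega u \<in> c_space t1 t2}"

end

theory Submission imports Defs begin

text \<open>
  A matrix acts on a fuzzy sequence \<open>u\<close> through its sequence \<open>x\<close> of middle points. Row \<open>n\<close> of
  \<open>\<Lambda>\<close> is the finite combination of the rows \<open>1, \<dots>, n\<close> of \<open>\<Delta>\<close> with weights \<open>1, \<dots>, n\<close>,
  that is, \<open>\<Lambda> = Omega \<Delta>\<close> as a matrix product.

  Since \<open>Omega\<close> is triangular with the nonzero diagonal entries \<open>1, 2, \<dots>\<close>, the rows of \<open>\<Delta>\<close>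
  are conversely finite combinations of rows of \<open>\<Lambda>\<close>: row \<open>n\<close> of \<open>\<Delta>\<close> is \<open>1 / n\<close> times the
  difference of two consecutive rows of \<open>\<Lambda>\<close>. Hence the series of all rows of \<open>\<Delta>\<close> converge at
  \<open>x\<close> exactly when those of \<open>\<Lambda>\<close> do (\<open>mat_summable_Omega_product_iff\<close>).

  When they converge, a finite sum may be exchanged with a convergent series, so
  \<open>Omega (\<Delta> u) = \<Lambda> u\<close> (\<open>mat_app_Omega_mat_app\<close>). Thus \<open>\<Delta> u\<close> lies in the \<open>Omega\<close>-domain
  of \<open>c_space\<close> exactly when \<open>\<Lambda> u\<close> lies in \<open>c_space\<close>. The equivalence therefore holds
  separately at each \<open>u\<close>, because the two sides test the same sequence for membership.
\<close>

lemma mat_app_in_omega: "mat_app t1 t2 A u \<in> omega t1 t2"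
  by (auto simp: mat_app_def omega_def F_def)

lemma mat_app_Omega:
  "mat_app t1 t2 Omega u = (\<lambda>n\<in>{1..}. tri t1 t2 (\<Sum>j=1..n. real j * mid (u j)))"
proof -
  have "(\<Sum>k. Omega n (Suc k) * mid (u (Suc k))) = (\<Sum>j=1..n. real j * mid (u j))" for n
  proof -
    have "(\<Sum>k. Omega n (Suc k) * mid (u (Suc k))) = (\<Sum>k<n. Omega n (Suc k) * mid (u (Suc k)))"
      by (rule suminf_finite) (auto simp: Omega_def)
    also have "\<dots> = (\<Sum>k<n. real (Suc k) * mid (u (Suc k)))"
      by (rule sum.cong) (auto simp: Omega_def)
    also have "\<dots> = (\<Sum>j=1..n. real j * mid (u j))"
      by (simp add: sum.atLeast1_atMost_eq)
    finally show ?thesis .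
  qed
  then show ?thesis
    by (simp add: mat_app_def)
qed

lemma Omega_product_row:
  fixes \<Delta> \<Lambda> :: "nat \<Rightarrow> nat \<Rightarrow> real"
  assumes "\<And>n k. n \<ge> 1 \<Longrightarrow> k \<ge> 1 \<Longrightarrow> \<Lambda> n k = (\<Sum>j=1..n. real j * \<Delta> j k)" and "n \<ge> 1"
  shows "\<Lambda> n (Suc k) * x = (\<Sum>j=1..n. real j * (\<Delta> j (Suc k) * x))"
  using assms by (simp add: sum_distrib_right mult.assoc)

text \<open>
  Invertibility of \<open>Omega\<close> at work: from left to right the series are added up, from right to
  left consecutive partial combinations are subtracted.
\<close>

lemma mat_summable_Omega_product_iff:
  fixes \<Delta> \<Lambda> :: "nat \<Rightarrow> nat \<Rightarrow> real"
  assumes "\<And>n k. n \<ge> 1 \<Longrightarrow> k \<ge> 1 \<Longrightarrow> \<Lambda> n k = (\<Sum>j=1..n. real j * \<Delta> j k)"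
  shows "mat_summable \<Delta> u \<longleftrightarrow> mat_summable \<Lambda> u"
proof
  assume "mat_summable \<Delta> u"
  then show "mat_summable \<Lambda> u"
    unfolding mat_summable_def
    by (auto simp: Omega_product_row[where \<Delta> = \<Delta> and \<Lambda> = \<Lambda>, OF assms]
        intro!: summable_sum summable_mult)
next
  assume \<Lambda>: "mat_summable \<Lambda> u"
  define S where "S n k = (\<Sum>j=1..n. real j * (\<Delta> j (Suc k) * mid (u (Suc k))))" for n k
  (* The empty sum S 0 plays the part of a zeroth row, so that n = 1 needs no separate case. *)
  have S: "summable (S n)" for n
  proof (cases "n = 0")
    case True
    then show ?thesis by (simp add: S_def[abs_def])
  next
    case False
    then have "S n = (\<lambda>k. \<Lambda> n (Suc k) * mid (u (Suc k)))"
      by (simp add: S_def Omega_product_row[where \<Delta> = \<Delta> and \<Lambda> = \<Lambda>, OF assms] fun_eq_iff)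
    with \<Lambda> False show ?thesis
      by (simp add: mat_summable_def)
  qed
  show "mat_summable \<Delta> u"
    unfolding mat_summable_def
  proof (intro allI impI)
    fix n :: nat
    assume "n \<ge> 1"
    then obtain m where m: "n = Suc m"
      by (cases n) auto
    have "summable (\<lambda>k. (S n k - S m k) / real n)"
      by (intro summable_divide summable_diff S)
    moreover have "(S n k - S m k) / real n = \<Delta> n (Suc k) * mid (u (Suc k))" for k
      by (simp add: S_def m del: of_nat_Suc)
    ultimately show "summable (\<lambda>k. \<Delta> n (Suc k) * mid (u (Suc k)))"
      by simp
  qed
qed

text \<open>
  Associativity \<open>Omega (\<Delta> u) = (Omega \<Delta>) u\<close>. The convergence hypothesis is what permits
  exchanging the finite sum over rows with the series over columns.
\<close>

lemma mat_app_Omega_mat_app: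
  fixes \<Delta> \<Lambda> :: "nat \<Rightarrow> nat \<Rightarrow> real"
  assumes "\<And>n k. n \<ge> 1 \<Longrightarrow> k \<ge> 1 \<Longrightarrow> \<Lambda> n k = (\<Sum>j=1..n. real j * \<Delta> j k)"
    and "mat_summable \<Delta> u"
  shows "mat_app t1 t2 Omega (mat_app t1 t2 \<Delta> u) = mat_app t1 t2 \<Lambda> u"
proof -
  have "(\<Sum>j=1..n. real j * mid (mat_app t1 t2 \<Delta> u j)) = (\<Sum>k. \<Lambda> n (Suc k) * mid (u (Suc k)))"
    if "n \<ge> 1" for n
  proof -
    have sm: "summable (\<lambda>k. \<Delta> j (Suc k) * mid (u (Suc k)))" if "j \<in> {1..n}" for j
      using assms(2) that by (simp add: mat_summable_def)
    have "(\<Sum>k. \<Lambda> n (Suc k) * mid (u (Suc k)))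
        = (\<Sum>k. \<Sum>j=1..n. real j * (\<Delta> j (Suc k) * mid (u (Suc k))))"
      using that by (simp add: Omega_product_row[where \<Delta> = \<Delta> and \<Lambda> = \<Lambda>, OF assms(1)])
    also have "\<dots> = (\<Sum>j=1..n. \<Sum>k. real j * (\<Delta> j (Suc k) * mid (u (Suc k))))"
      by (rule suminf_sum) (intro summable_mult sm)
    also have "\<dots> = (\<Sum>j=1..n. real j * mid (mat_app t1 t2 \<Delta> u j))"
      by (rule sum.cong) (use sm in \<open>auto simp: mat_app_def suminf_mult\<close>)
    finally show ?thesis ..
  qed
  then show ?thesis
    unfolding mat_app_Omega by (auto simp: mat_app_def[of t1 t2 \<Lambda>] fun_eq_iff)
qed

theorem theorem4p3:
  fixes t1 t2 :: real
    and X :: "(nat \<Rightarrow> tfn) set"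
    and \<Delta> \<Lambda> :: "nat \<Rightarrow> nat \<Rightarrow> real"
  assumes "t1 \<le> t2"
    and "sequence_space t1 t2 X"
    and "\<And>n k. n \<ge> 1 \<Longrightarrow> k \<ge> 1 \<Longrightarrow> \<Lambda> n k = (\<Sum>j=1..n. real j * \<Delta> j k)"
  shows "\<Delta> \<in> mat_class t1 t2 X (c_Omega t1 t2) \<longleftrightarrow> \<Lambda> \<in> mat_class t1 t2 X (c_space t1 t2)"
proof -
  have "mat_summable \<Delta> u \<and> mat_app t1 t2 \<Delta> u \<in> c_Omega t1 t2 \<longleftrightarrow>
      mat_summable \<Lambda> u \<and> mat_app t1 t2 \<Lambda> u \<in> c_space t1 t2" for u
    using mat_summable_Omega_product_iff[of \<Lambda> \<Delta> u] mat_app_Omega_mat_app[of \<Lambda> \<Delta> u t1 t2]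
      assms(3) mat_app_in_omega[of t1 t2 \<Delta> u]
    by (auto simp: c_Omega_def)
  then show ?thesis
    by (simp add: mat_class_def)
qed

end
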